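(* Let $n,k\ge 1$ and let $Q_1,\dots,Q_k\in\mathbb{R}^{n\times n}$ be symmetric positive definite matrices. Let $\mathcal{H}=\bigoplus_{i=1}^k\mathcal{E}(Q_i)$ be the geometric (Minkowski) sum of the ellipsoids $\mathcal{E}(Q_1),\dots,\mathcal{E}(Q_k)$. Then the boundary of $\mathcal{H}$ is exactly $$\partial\mathcal{H}=\left\{\,\sum_{i=1}^{k}\langle \ell,Q_i\ell\rangle^{-\frac12}\,Q_i\ell\ \Big|\ \ell\in\mathbb{R}^n,\ \|\ell\|=1\right\}.$$
   Context: For a symmetric positive definite matrix $Q\in\mathbb{R}^{n\times n}$, the ellipsoid centered at zero with shape matrix $Q$ is $\mathcal{E}(Q)=\{\xi\in\mathbb{R}^n\mid \xi^TQ^{-1}\xi\le 1\}$. The geometric (Minkowski) sum of convex sets $\mathcal{S}_1,\mathcal{S}_2\subset\mathbb{R}^n$ is $\mathcal{S}_1\oplus\mathcal{S}_2=\{s_1+s_2\mid s_1\in\mathcal{S}_1,\ s_2\in\mathcal{S}_2\}$, and $\bigoplus_{i=1}^k$ denotes the iterated sum. $\langle\cdot,\cdot\rangle$ is the standard inner product and $\|\cdot\|$ the Euclidean norm on $\mathbb{R}^n$; $\partial$ denotes topological boundary. *)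

theory Defs
  imports "HOL-Analysis.Analysis" "HOL-Library.Set_Algebras"
begin

definition sym_pos_def :: "real ^ 'n ^ 'n \<Rightarrow> bool" where
  "sym_pos_def Q \<longleftrightarrow> transpose Q = Q \<and> (\<forall>x. x \<noteq> 0 \<longrightarrow> x \<bullet> (Q *v x) > 0)"

(* matrix_inv Q is an unspecified matrix when Q is singular, so this is the intended ellipsoid
   only for invertible Q, in particular for every Q satisfying sym_pos_def. *)
definition ellipsoid :: "real ^ 'n ^ 'n \<Rightarrow> (real ^ 'n) set" where
  "ellipsoid Q = {\<xi>. \<xi> \<bullet> (matrix_inv Q *v \<xi>) \<le> 1}"

(* The geometric (Minkowski) sum S + T is the set addition of HOL-Library.Set_Algebras; the sum
   operator over sets of vectors is its iteration. *)

end

theory Submission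
  imports Defs
begin

text \<open>
  The argument is support-function duality.  In a direction \<open>l \<noteq> 0\<close> the linear functional
  \<open>x \<mapsto> l \<bullet> x\<close> has exactly one maximiser on the ellipsoid of \<open>Q\<close>, namely
  \<open>Q l / sqrt (l \<bullet> Q l)\<close>.  Existence and uniqueness both come from the positive definiteness of \<open>Q\<close>:
  expanding the square of a difference in the inner product defined by \<open>Q\<close> yields the Cauchy-Schwarz
  inequality together with its equality case (\<open>inner_le_one_on_ellipsoid\<close>).

  A maximiser of \<open>l\<close> over a Minkowski sum is a sum of maximisers over the summands, so \<open>l\<close> is
  maximised over \<open>H\<close> exactly at the sum of the individual support points.  The sum \<open>H\<close> is convex
  and compact, and a point of such a set lies on the frontier iff some nonzero functional attains
  its maximum there: supporting hyperplanes give one direction, and a nonzero functional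
  has no maximum over an open set for the other.  Letting \<open>l\<close> run
  over the unit sphere covers all nonzero functionals up to positive scaling, which gives the
  parametrisation.
\<close>

section \<open>Supporting functionals of convex sets\<close>

text \<open>A convex set without interior lies in a hyperplane, which then supports it everywhere; with
  nonempty interior, the relative interior is the interior and the relative statement applies.\<close>

lemma supporting_functional_not_interior:
  fixes S :: "'a::euclidean_space set"
  assumes "convex S" "x \<in> S" "x \<notin> interior S"
  obtains l where "norm l = 1" "\<And>y. y \<in> S \<Longrightarrow> l \<bullet> y \<le> l \<bullet> x"
proof -
  obtain a where a: "a \<noteq> 0" "\<And>y. y \<in> S \<Longrightarrow> a \<bullet> x \<le> a \<bullet> y"
  proof (cases "interior S = {}")
    case True
    then obtain a b where "a \<noteq> 0" and S: "S \<subseteq> {x. a \<bullet> x = b}"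
      using empty_interior_subset_hyperplane[OF \<open>convex S\<close>] by metis
    moreover have "a \<bullet> x \<le> a \<bullet> y" if "y \<in> S" for y
      using subsetD[OF S \<open>x \<in> S\<close>] subsetD[OF S that] by simp
    ultimately show ?thesis
      using that by metis
  next
    case False
    then have "x \<notin> rel_interior S"
      using assms(3) by (simp add: rel_interior_nonempty_interior)
    then show ?thesis
      using supporting_hyperplane_rel_boundary[OF assms(1,2)] that by metis
  qed
  define l where "l = (- 1 / norm a) *\<^sub>R a"
  have "norm l = 1"
    using a(1) by (simp add: l_def)
  moreover have "l \<bullet> y \<le> l \<bullet> x" if "y \<in> S" for y
    using a(2)[OF that] a(1) by (simp add: l_def divide_right_mono)
  ultimately show ?thesis
    by (rule that)
qed

lemma maximiser_not_interior:
  fixes S :: "'a::euclidean_space set"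
  assumes "l \<noteq> 0" and max: "\<And>y. y \<in> S \<Longrightarrow> l \<bullet> y \<le> l \<bullet> x"
  shows "x \<notin> interior S"
proof -
  have "interior S \<subseteq> interior {y. l \<bullet> y \<le> l \<bullet> x}"
    using max by (intro interior_mono) auto
  then show ?thesis
    using \<open>l \<noteq> 0\<close> by auto
qed

lemma compact_set_sum:
  fixes S :: "'i \<Rightarrow> 'a::real_normed_vector set"
  assumes "\<And>i. i \<in> I \<Longrightarrow> compact (S i)"
  shows "compact (\<Sum>i\<in>I. S i)"
  using assms
proof (induction I rule: infinite_finite_induct)
  case (insert i I)
  have "compact {x + y | x y. x \<in> S i \<and> y \<in> (\<Sum>i\<in>I. S i)}"
    using insert by (intro compact_sums) auto
  also have "{x + y | x y. x \<in> S i \<and> y \<in> (\<Sum>i\<in>I. S i)} = (\<Sum>i\<in>insert i I. S i)"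
    using insert by (auto simp: set_plus_def)
  finally show ?case .
qed (simp_all add: set_zero)

text \<open>The inequalities \<open>l \<bullet> s i \<le> l \<bullet> p i\<close> can only add up to an equality if each of them is one.\<close>

lemma maximiser_set_sum_unique:
  fixes S :: "'i \<Rightarrow> 'a::real_inner set"
  assumes "finite I"
    and p: "\<And>i. i \<in> I \<Longrightarrow> p i \<in> S i"
    and le: "\<And>i y. i \<in> I \<Longrightarrow> y \<in> S i \<Longrightarrow> l \<bullet> y \<le> l \<bullet> p i"
    and uniq: "\<And>i y. i \<in> I \<Longrightarrow> y \<in> S i \<Longrightarrow> l \<bullet> y = l \<bullet> p i \<Longrightarrow> y = p i"
    and "x \<in> (\<Sum>i\<in>I. S i)"
    and max: "\<And>y. y \<in> (\<Sum>i\<in>I. S i) \<Longrightarrow> l \<bullet> y \<le> l \<bullet> x"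
  shows "x = (\<Sum>i\<in>I. p i)"
proof -
  obtain s where s: "x = sum s I" "\<And>i. i \<in> I \<Longrightarrow> s i \<in> S i"
    using \<open>x \<in> _\<close> by (auto simp: set_sum_alt[OF \<open>finite I\<close>])
  have "sum p I \<in> (\<Sum>i\<in>I. S i)"
    using p by (auto simp: set_sum_alt[OF \<open>finite I\<close>])
  then have "(\<Sum>i\<in>I. l \<bullet> p i) \<le> (\<Sum>i\<in>I. l \<bullet> s i)"
    using max[of "sum p I"] by (simp add: s(1) inner_sum_right)
  moreover have "(\<Sum>i\<in>I. l \<bullet> s i) \<le> (\<Sum>i\<in>I. l \<bullet> p i)"
    using le s(2) by (intro sum_mono) auto
  ultimately have eq: "(\<Sum>i\<in>I. l \<bullet> s i) = (\<Sum>i\<in>I. l \<bullet> p i)"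
    by linarith
  have "l \<bullet> s i = l \<bullet> p i" if "i \<in> I" for i
    by (rule sum_mono_inv[OF eq _ that \<open>finite I\<close>]) (rule le[OF _ s(2)])
  then have "s i = p i" if "i \<in> I" for i
    using uniq s(2) that by blast
  then show ?thesis
    unfolding s(1) by (rule sum.cong[OF refl])
qed

lemma maximiser_set_sum:
  fixes S :: "'i \<Rightarrow> 'a::real_inner set"
  assumes "finite I"
    and le: "\<And>i y. i \<in> I \<Longrightarrow> y \<in> S i \<Longrightarrow> l \<bullet> y \<le> l \<bullet> p i"
    and "y \<in> (\<Sum>i\<in>I. S i)"
  shows "l \<bullet> y \<le> l \<bullet> (\<Sum>i\<in>I. p i)"
  using assms by (auto simp: set_sum_alt[OF \<open>finite I\<close>] inner_sum_right intro!: sum_mono)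

section \<open>Support points of an ellipsoid\<close>

lemma sym_pos_def_inner_commute:
  assumes "sym_pos_def Q"
  shows "x \<bullet> (Q *v y) = y \<bullet> (Q *v x)"
  using assms dot_lmul_matrix[of x Q y]
  by (metis inner_commute sym_pos_def_def transpose_matrix_vector)

lemma sym_pos_def_matrix_inv:
  assumes "sym_pos_def Q"
  shows "Q *v (matrix_inv Q *v x) = x" "matrix_inv Q *v (Q *v x) = x"
proof -
  have "\<forall>x. Q *v x = 0 \<longrightarrow> x = 0"
    using assms unfolding sym_pos_def_def by (metis inner_zero_right less_irrefl)
  then have "invertible Q"
    by (simp add: invertible_left_inverse matrix_left_invertible_ker)
  then have "Q ** matrix_inv Q = mat 1 \<and> matrix_inv Q ** Q = mat 1"
    unfolding invertible_def matrix_inv_def by (rule someI_ex)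
  then show "Q *v (matrix_inv Q *v x) = x" "matrix_inv Q *v (Q *v x) = x"
    by (simp_all add: matrix_vector_mul_assoc)
qed

lemma mem_ellipsoid_image:
  assumes "sym_pos_def Q"
  shows "Q *v u \<in> ellipsoid Q \<longleftrightarrow> u \<bullet> (Q *v u) \<le> 1"
  by (simp add: ellipsoid_def sym_pos_def_matrix_inv[OF assms] inner_commute)

text \<open>Cauchy-Schwarz for the inner product \<open>(u, v) \<mapsto> u \<bullet> Q v\<close>, with its equality case: for
  \<open>x = Q v\<close>, the quantity \<open>(v - u) \<bullet> Q (v - u)\<close> is at most \<open>2 - 2 (u \<bullet> x)\<close>, and it is
  positive unless \<open>v = u\<close>.\<close>

lemma inner_le_one_on_ellipsoid:
  assumes Q: "sym_pos_def Q" and u: "u \<bullet> (Q *v u) = 1" and x: "x \<in> ellipsoid Q"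
  shows "u \<bullet> x \<le> 1" and "u \<bullet> x = 1 \<Longrightarrow> x = Q *v u"
proof -
  define v where "v = matrix_inv Q *v x"
  have xv: "x = Q *v v"
    by (simp add: v_def sym_pos_def_matrix_inv[OF Q])
  have "v \<bullet> (Q *v v) \<le> 1"
    using x mem_ellipsoid_image[OF Q] xv by simp
  moreover have "(v - u) \<bullet> (Q *v (v - u)) = v \<bullet> (Q *v v) - 2 * (u \<bullet> x) + 1"
    using sym_pos_def_inner_commute[OF Q, of v u] u
    by (simp add: xv matrix_vector_mult_diff_distrib inner_diff_left inner_diff_right)
  ultimately have *: "(v - u) \<bullet> (Q *v (v - u)) \<le> 2 - 2 * (u \<bullet> x)"
    by simp
  have pos: "(v - u) \<bullet> (Q *v (v - u)) > 0" if "v \<noteq> u"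
    using Q that by (simp add: sym_pos_def_def)
  show "u \<bullet> x \<le> 1"
    using * pos u xv by (cases "v = u") auto
  show "x = Q *v u" if "u \<bullet> x = 1"
    using * pos that xv by (cases "v = u") auto
qed

definition support_point :: "real ^ 'n ^ 'n \<Rightarrow> real ^ 'n \<Rightarrow> real ^ 'n" where
  "support_point Q l = (l \<bullet> (Q *v l)) powr (- 1 / 2) *\<^sub>R (Q *v l)"

lemma support_point_properties:
  assumes Q: "sym_pos_def Q" and l: "l \<noteq> 0"
  shows support_point_mem: "support_point Q l \<in> ellipsoid Q"
    and inner_support_point: "l \<bullet> support_point Q l = sqrt (l \<bullet> (Q *v l))"
    and inner_le_support_point: "x \<in> ellipsoid Q \<Longrightarrow> l \<bullet> x \<le> l \<bullet> support_point Q l"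
    and support_point_unique:
      "x \<in> ellipsoid Q \<Longrightarrow> l \<bullet> x = l \<bullet> support_point Q l \<Longrightarrow> x = support_point Q l"
proof -
  \<comment> \<open>Rescaling \<open>l\<close> to length one for the inner product defined by \<open>Q\<close> turns the support point
      into \<open>Q u\<close>.\<close>
  define t where "t = sqrt (l \<bullet> (Q *v l))"
  define u where "u = (1 / t) *\<^sub>R l"
  have pos: "l \<bullet> (Q *v l) > 0"
    using Q l by (simp add: sym_pos_def_def)
  then have t: "t > 0" "t * t = l \<bullet> (Q *v l)"
    by (simp_all add: t_def)
  have lu: "l = t *\<^sub>R u"
    using t by (simp add: u_def)
  have u: "u \<bullet> (Q *v u) = 1"
    using t by (simp add: u_def matrix_vector_mult_scaleR flip: t(2))
  have "(l \<bullet> (Q *v l)) powr (- 1 / 2) = 1 / t"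
    using pos powr_minus_divide[of "l \<bullet> (Q *v l)" "1 / 2"] by (simp add: t_def powr_half_sqrt)
  then have sp: "support_point Q l = Q *v u"
    by (simp add: support_point_def u_def matrix_vector_mult_scaleR)
  show "support_point Q l \<in> ellipsoid Q"
    using u by (simp add: sp mem_ellipsoid_image[OF Q])
  have lsp: "l \<bullet> support_point Q l = t"
    unfolding sp by (simp add: lu u)
  then show "l \<bullet> support_point Q l = sqrt (l \<bullet> (Q *v l))"
    by (simp add: t_def)
  show "l \<bullet> x \<le> l \<bullet> support_point Q l" if "x \<in> ellipsoid Q"
    using inner_le_one_on_ellipsoid(1)[OF Q u that] t(1) unfolding lsp by (simp add: lu)
  show "x = support_point Q l" if "x \<in> ellipsoid Q" "l \<bullet> x = l \<bullet> support_point Q l"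
  proof -
    have "u \<bullet> x = 1"
      using that(2) t(1) unfolding lsp by (simp add: lu)
    then show ?thesis
      using inner_le_one_on_ellipsoid(2)[OF Q u that(1)] by (simp add: sp)
  qed
qed

text \<open>This form makes closedness and convexity immediate.  For the inclusion from right to left, the
  direction to test against \<open>x\<close> is \<open>l = Q\<^sup>-\<^sup>1 x\<close>: there the inequality reads \<open>q \<le> sqrt q\<close> with
  \<open>q = x \<bullet> Q\<^sup>-\<^sup>1 x\<close>, which forces \<open>q \<le> 1\<close>.\<close>

lemma ellipsoid_eq_Inter_halfspaces:
  assumes Q: "sym_pos_def Q"
  shows "ellipsoid Q = (\<Inter>l\<in>-{0}. {x. l \<bullet> x \<le> sqrt (l \<bullet> (Q *v l))})"
proof (intro equalityI subsetI)
  fix x assume "x \<in> ellipsoid Q"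
  then show "x \<in> (\<Inter>l\<in>-{0}. {x. l \<bullet> x \<le> sqrt (l \<bullet> (Q *v l))})"
    using inner_le_support_point[OF Q] inner_support_point[OF Q] by auto
next
  fix x assume x: "x \<in> (\<Inter>l\<in>-{0}. {x. l \<bullet> x \<le> sqrt (l \<bullet> (Q *v l))})"
  define v where "v = matrix_inv Q *v x"
  have xv: "x = Q *v v"
    by (simp add: v_def sym_pos_def_matrix_inv[OF Q])
  have "v \<bullet> (Q *v v) \<le> 1"
  proof (cases "v = 0")
    case False
    define q where "q = v \<bullet> (Q *v v)"
    have "q > 0"
      using Q False by (simp add: q_def sym_pos_def_def)
    have "q \<le> sqrt q"
      using x False by (auto simp: xv q_def)
    then have "q\<^sup>2 \<le> q"
      using \<open>q > 0\<close> power_mono[of q "sqrt q" 2] by simp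
    then show ?thesis
      using \<open>q > 0\<close> by (simp add: power2_eq_square flip: q_def)
  qed simp
  then show "x \<in> ellipsoid Q"
    by (simp add: xv mem_ellipsoid_image[OF Q])
qed

lemma convex_ellipsoid:
  assumes "sym_pos_def Q"
  shows "convex (ellipsoid Q)"
  unfolding ellipsoid_eq_Inter_halfspaces[OF assms] by (intro convex_INT convex_halfspace_le)

lemma compact_ellipsoid:
  fixes Q :: "real ^ 'n ^ 'n"
  assumes Q: "sym_pos_def Q"
  shows "compact (ellipsoid Q)"
proof -
  have "closed (ellipsoid Q)"
    unfolding ellipsoid_eq_Inter_halfspaces[OF Q] by (intro closed_INT ballI closed_halfspace_le)
  moreover have "bounded (ellipsoid Q)"
    unfolding bounded_iff
  proof (intro exI ballI)
    fix x assume x: "x \<in> ellipsoid Q"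
    have "\<bar>x \<bullet> b\<bar> \<le> sqrt (b \<bullet> (Q *v b))" if "b \<in> Basis" for b
    proof -
      have "b \<noteq> 0"
        using that by (rule nonzero_Basis)
      have "l \<bullet> x \<le> sqrt (l \<bullet> (Q *v l))" if "l \<noteq> 0" for l
        using x that unfolding ellipsoid_eq_Inter_halfspaces[OF Q] by auto
      from this[of b] this[of "- b"] show ?thesis
        using \<open>b \<noteq> 0\<close> matrix_vector_mult_scaleR[of Q "-1" b] by (simp add: inner_commute abs_le_iff)
    qed
    then have "(\<Sum>b\<in>Basis. \<bar>x \<bullet> b\<bar>) \<le> (\<Sum>b\<in>Basis. sqrt (b \<bullet> (Q *v b)))"
      by (rule sum_mono)
    then show "norm x \<le> (\<Sum>b\<in>Basis. sqrt (b \<bullet> (Q *v b)))"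
      using norm_le_l1[of x] by linarith
  qed
  ultimately show ?thesis
    by (simp add: compact_eq_bounded_closed)
qed

section \<open>The boundary of a Minkowski sum of ellipsoids\<close>

theorem theorem1:
  fixes Q :: "nat \<Rightarrow> real ^ 'n ^ 'n" and k :: nat and H :: "(real ^ 'n) set"
  assumes "k \<ge> 1"
    and "\<And>i. i \<in> {1..k} \<Longrightarrow> sym_pos_def (Q i)"
    and "H = (\<Sum>i = 1..k. ellipsoid (Q i))"
  shows "frontier H =
    {(\<Sum>i = 1..k. (l \<bullet> (Q i *v l)) powr (- 1 / 2) *\<^sub>R (Q i *v l)) | l. norm l = 1}"
proof -
  have "convex H" "compact H"
    unfolding assms(3) using assms(2)
    by (auto intro!: convex_set_sum convex_ellipsoid compact_set_sum compact_ellipsoid)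
  then have frontier: "frontier H = H - interior H"
    by (simp add: frontier_def compact_imp_closed)
  have "frontier H = {\<Sum>i = 1..k. support_point (Q i) l | l. norm l = 1}"
  proof (intro equalityI subsetI)
    fix x assume "x \<in> frontier H"
    then have x: "x \<in> H" "x \<notin> interior H"
      by (simp_all add: frontier)
    obtain l where l: "norm l = 1" "\<And>y. y \<in> H \<Longrightarrow> l \<bullet> y \<le> l \<bullet> x"
      using supporting_functional_not_interior[OF \<open>convex H\<close> x] by blast
    then have "l \<noteq> 0"
      by auto
    have "x = (\<Sum>i = 1..k. support_point (Q i) l)"
      using assms(2) \<open>l \<noteq> 0\<close> x(1) l(2) unfolding assms(3)
      by (intro maximiser_set_sum_unique[where l = l and S = "\<lambda>i. ellipsoid (Q i)"]
            support_point_mem inner_le_support_point support_point_unique) auto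
    then show "x \<in> {\<Sum>i = 1..k. support_point (Q i) l | l. norm l = 1}"
      using l(1) by blast
  next
    fix x assume "x \<in> {\<Sum>i = 1..k. support_point (Q i) l | l. norm l = 1}"
    then obtain l where l: "norm l = 1" and x: "x = (\<Sum>i = 1..k. support_point (Q i) l)"
      by blast
    then have "l \<noteq> 0"
      by auto
    have "x \<in> H"
      unfolding assms(3) x set_sum_alt[OF finite_atLeastAtMost]
      using support_point_mem[OF assms(2) \<open>l \<noteq> 0\<close>] by blast
    moreover have "l \<bullet> y \<le> l \<bullet> x" if "y \<in> H" for y
      using that assms(2) \<open>l \<noteq> 0\<close> unfolding assms(3) x
      by (intro maximiser_set_sum[where S = "\<lambda>i. ellipsoid (Q i)"] inner_le_support_point) auto
    then have "x \<notin> interior H"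
      by (rule maximiser_not_interior[OF \<open>l \<noteq> 0\<close>])
    ultimately show "x \<in> frontier H"
      by (simp add: frontier)
  qed
  then show ?thesis
    by (simp only: support_point_def)
qed

end
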